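(* Let $X_{ij}\sim F_i$, $1\le j\le n_i$, $i=1,2$, be independent random samples with common mean $\mu=\mu_1=\mu_2$ and arbitrary variances $\sigma_1^2$ and $\sigma_2^2$, let $n=n_1+n_2$, and suppose $\lim_{\min(n_1,n_2)\to\infty}n_i/n=\lambda_i$, $i=1,2$, for $\lambda_1,\lambda_2\in(0,1)$. Let $\widehat\mu_n(\gamma)=\gamma_n\overline X_1+(1-\gamma_n)\overline X_2$ be the common mean estimator with random weight $$\gamma_n=\begin{cases}\gamma^{\le}(n_1/n,n_2/n,\widetilde S_1^2,\widetilde S_2^2,\overline X_1,\overline X_2),&\widetilde S_1^2\le\widetilde S_2^2,\\ \gamma^{>}(n_1/n,n_2/n,\widetilde S_1^2,\widetilde S_2^2,\overline X_1,\overline X_2),&\widetilde S_1^2>\widetilde S_2^2,\end{cases}$$ or of the same form with $S_1^2,S_2^2$ in place of $\widetilde S_1^2,\widetilde S_2^2$, where $\gamma^{\le}$ and $\gamma^{>}$ are three times continuously differentiable functions with bounded third partial derivatives. Then $\widehat\mu_n(\gamma)$ satisfies the central limit theorem $$\sqrt n\,[\widehat\mu_n(\gamma)-\mu]\to N(0,\sigma^2(\gamma))\quad\text{in distribution},$$ as $n\to\infty$, where the asymptotic variance is given by $$\sigma^2(\gamma)=\gamma^2\lambda_1^{-1}\sigma_1^2+(1-\gamma)^2\lambda_2^{-1}\sigma_2^2 .$$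
   Context: $\overline X_i=\frac1{n_i}\sum_{j=1}^{n_i}X_{ij}$, $S_i^2=\frac1{n_i}\sum_{j=1}^{n_i}(X_{ij}-\overline X_i)^2$, $\widetilde S_i^2=\frac{n_i}{n_i-1}S_i^2$, $\sigma_i^2=\mathrm{Var}(X_{i1})$. The quantity $\gamma$ in the asymptotic variance is $$\gamma=\gamma^{\le}\mathbf 1_{\{\sigma_1^2<\sigma_2^2\}}+\gamma^{>}\mathbf 1_{\{\sigma_1^2>\sigma_2^2\}},$$ with $\gamma^{\le},\gamma^{>}$ evaluated at the limit $\theta=(\lambda_1,\lambda_2,\sigma_1^2,\sigma_2^2,\mu,\mu)$ of their arguments. Ordered variances are not required.
   Formalization: For equal variances the stated γ is 0 (strict indicators) and the claim fails, e.g. for both weights constantly 1/2; the formal theorem then assumes that γ^≤ and γ^> both equal γ, i.e. vanish, at θ. Unequal variances in either order are fully covered. *)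

theory Defs
  imports "HOL-Probability.Probability"
begin

section \<open>Smoothness\<close>

definition partial_deriv :: "'a::euclidean_space \<Rightarrow> ('a \<Rightarrow> real) \<Rightarrow> 'a \<Rightarrow> real" where
  "partial_deriv b f x = frechet_derivative f (at x) b"

text \<open>\<open>Ck_on k f U\<close>: on the open set \<open>U\<close>, \<open>f\<close> is \<open>k\<close> times continuously differentiable.\<close>

fun Ck_on :: "nat \<Rightarrow> ('a::euclidean_space \<Rightarrow> real) \<Rightarrow> 'a set \<Rightarrow> bool" where
  "Ck_on 0 f U \<longleftrightarrow> continuous_on U f"
| "Ck_on (Suc k) f U \<longleftrightarrow>
     f differentiable_on U \<and> (\<forall>b\<in>Basis. Ck_on k (partial_deriv b f) U)"

definition bounded_third_partials_on :: "('a::euclidean_space \<Rightarrow> real) \<Rightarrow> 'a set \<Rightarrow> bool" where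
  "bounded_third_partials_on f U \<longleftrightarrow>
     (\<exists>B. \<forall>b\<in>Basis. \<forall>c\<in>Basis. \<forall>d\<in>Basis. \<forall>x\<in>U.
        \<bar>partial_deriv b (partial_deriv c (partial_deriv d f)) x\<bar> \<le> B)"

section \<open>Sample statistics\<close>

text \<open>A sample is a sequence of random variables whose first \<open>n\<close> members have the
  indices \<open>1, \<dots>, n\<close>.\<close>

definition sample_mean :: "(nat \<Rightarrow> 'w \<Rightarrow> real) \<Rightarrow> nat \<Rightarrow> 'w \<Rightarrow> real" where
  "sample_mean Y n \<omega> = (\<Sum>j=1..n. Y j \<omega>) / real n"

definition sample_var :: "(nat \<Rightarrow> 'w \<Rightarrow> real) \<Rightarrow> nat \<Rightarrow> 'w \<Rightarrow> real" where
  "sample_var Y n \<omega> = (\<Sum>j=1..n. (Y j \<omega> - sample_mean Y n \<omega>)\<^sup>2) / real n"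

definition unbiased_sample_var :: "(nat \<Rightarrow> 'w \<Rightarrow> real) \<Rightarrow> nat \<Rightarrow> 'w \<Rightarrow> real" where
  "unbiased_sample_var Y n \<omega> = real n / (real n - 1) * sample_var Y n \<omega>"

section \<open>Common mean estimators\<close>

text \<open>Arguments of the weight functions: the two sample fractions, the two variances, the two
  means.\<close>

type_synonym weight_args = "real \<times> real \<times> real \<times> real \<times> real \<times> real"

text \<open>The values these arguments can take: sample fractions lie in the open unit interval, and
  sample variances may vanish.\<close>

definition weight_range :: "weight_args set" where
  "weight_range = {(l1, l2, s1, s2, m1, m2).
     0 < l1 \<and> l1 < 1 \<and> 0 < l2 \<and> l2 < 1 \<and> 0 \<le> s1 \<and> 0 \<le> s2}"

text \<open>The random weight. The argument \<open>V\<close> is the variance estimator, \<open>sample_var\<close> or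
  \<open>unbiased_sample_var\<close>; \<open>X 1\<close> and \<open>X 2\<close> are the two samples.\<close>

definition random_weight ::
  "((nat \<Rightarrow> 'w \<Rightarrow> real) \<Rightarrow> nat \<Rightarrow> 'w \<Rightarrow> real) \<Rightarrow> (weight_args \<Rightarrow> real) \<Rightarrow> (weight_args \<Rightarrow> real)
     \<Rightarrow> (nat \<Rightarrow> nat \<Rightarrow> 'w \<Rightarrow> real) \<Rightarrow> nat \<Rightarrow> nat \<Rightarrow> 'w \<Rightarrow> real" where
  "random_weight V gle ggt X n1 n2 \<omega> =
     (let args = (real n1 / real (n1 + n2), real n2 / real (n1 + n2),
                  V (X 1) n1 \<omega>, V (X 2) n2 \<omega>,
                  sample_mean (X 1) n1 \<omega>, sample_mean (X 2) n2 \<omega>)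
      in if V (X 1) n1 \<omega> \<le> V (X 2) n2 \<omega> then gle args else ggt args)"

definition common_mean_estimator ::
  "((nat \<Rightarrow> 'w \<Rightarrow> real) \<Rightarrow> nat \<Rightarrow> 'w \<Rightarrow> real) \<Rightarrow> (weight_args \<Rightarrow> real) \<Rightarrow> (weight_args \<Rightarrow> real)
     \<Rightarrow> (nat \<Rightarrow> nat \<Rightarrow> 'w \<Rightarrow> real) \<Rightarrow> nat \<Rightarrow> nat \<Rightarrow> 'w \<Rightarrow> real" where
  "common_mean_estimator V gle ggt X n1 n2 \<omega> =
     random_weight V gle ggt X n1 n2 \<omega> * sample_mean (X 1) n1 \<omega>
     + (1 - random_weight V gle ggt X n1 n2 \<omega>) * sample_mean (X 2) n2 \<omega>"

text \<open>Both indicators are strict, so the value is 0 when \<open>s1 = s2\<close>.\<close>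

definition limit_weight ::
  "(weight_args \<Rightarrow> real) \<Rightarrow> (weight_args \<Rightarrow> real) \<Rightarrow> real \<Rightarrow> real \<Rightarrow> real \<Rightarrow> real \<Rightarrow> real \<Rightarrow> real" where
  "limit_weight gle ggt l1 l2 s1 s2 m =
     gle (l1, l2, s1, s2, m, m) * of_bool (s1 < s2)
     + ggt (l1, l2, s1, s2, m, m) * of_bool (s1 > s2)"

definition asymptotic_var :: "real \<Rightarrow> real \<Rightarrow> real \<Rightarrow> real \<Rightarrow> real \<Rightarrow> real" where
  "asymptotic_var g l1 l2 s1 s2 = g\<^sup>2 * inverse l1 * s1 + (1 - g)\<^sup>2 * inverse l2 * s2"

text \<open>The normal law with mean \<open>m\<close> and variance \<open>v\<close>. For \<open>v = 0\<close> it is the point mass at \<open>m\<close>;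
  the library's \<open>normal_density m 0\<close> is identically 0, not a probability density.\<close>

definition normal_law :: "real \<Rightarrow> real \<Rightarrow> real measure" where
  "normal_law m v =
     (if v = 0 then return borel m else density lborel (normal_density m (sqrt v)))"

end

theory Submission
  imports Defs
begin

text \<open>
  Let \<open>a\<close> and \<open>b\<close> be the two sample means and \<open>G\<close> the random weight. The weights \<open>G\<close> and \<open>1 - G\<close> sum to 1
  and both means estimate the same \<open>\<mu>\<close>, so the error is exactly

    \<open>sqrt n (G a + (1 - G) b - \<mu>) = sqrt n (g (a - \<mu>) + (1 - g) (b - \<mu>)) + (G - g) sqrt n (a - b)\<close>.

  The first summand has the deterministic weight \<open>g\<close>. Its characteristic function is a product of
  powers of the characteristic functions of the two laws, and converges to that of the normal law
  with the asserted variance (\<open>char_weighted_means_tendsto\<close>).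

  The second summand vanishes in the limit. Since \<open>a\<close> and \<open>b\<close> have the same expectation,
  \<open>sqrt n (a - b)\<close> is bounded in \<open>L\<^sup>1\<close>. The sample variances and means converge in probability by the
  weak law of large numbers, and the weight is a function of them and of the sample fractions that is
  continuous at the limit, so \<open>G - g\<close> tends to zero in probability (\<open>random_weight_tends_in_prob\<close>).
  At a tie of the two variances that continuity rests on both weight functions having the value \<open>g\<close>
  at the limit: the order of the sample variances, and with it the branch in use, need not
  settle there.

  A product of this kind does not change the limit of characteristic functions
  (\<open>char_distr_Slutsky\<close>), and Levy's continuity theorem turns their convergence into convergence in
  distribution.
\<close>

section \<open>Convergence in probability to a constant\<close>

text \<open>Convergence in probability to a constant. The exceptional set is any small event outside of
  which \<open>Y k\<close> lies in the given neighbourhood, so \<open>Y k\<close> itself may fail to be measurable. A random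
  weight is built from functions that are well behaved only on an open set; with this formulation
  its convergence can be derived before anything is known about its measurability.\<close>

definition tends_in_prob ::
  "'w measure \<Rightarrow> ('k \<Rightarrow> 'w \<Rightarrow> 'a::topological_space) \<Rightarrow> 'a \<Rightarrow> 'k filter \<Rightarrow> bool" where
  "tends_in_prob M Y c G \<longleftrightarrow>
     (\<forall>S e. open S \<longrightarrow> c \<in> S \<longrightarrow> 0 < e \<longrightarrow>
        (\<forall>\<^sub>F k in G. \<exists>A\<in>sets M. measure M A < e \<and> (\<forall>\<omega>\<in>space M - A. Y k \<omega> \<in> S)))"

lemma tends_in_probD:
  assumes "tends_in_prob M Y c G" "open S" "c \<in> S" "0 < e"
  shows "\<forall>\<^sub>F k in G. \<exists>A\<in>sets M. measure M A < e \<and> (\<forall>\<omega>\<in>space M - A. Y k \<omega> \<in> S)"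
  using assms unfolding tends_in_prob_def by blast

lemma tends_in_prob_const:
  assumes "(a \<longlongrightarrow> c) G"
  shows "tends_in_prob M (\<lambda>k \<omega>. a k) c G"
  unfolding tends_in_prob_def
proof (intro allI impI)
  fix S and e :: real assume "open S" "c \<in> S" "0 < e"
  then have "\<forall>\<^sub>F k in G. a k \<in> S"
    using assms by (auto dest: topological_tendstoD)
  then show "\<forall>\<^sub>F k in G. \<exists>A\<in>sets M. measure M A < e \<and> (\<forall>\<omega>\<in>space M - A. a k \<in> S)"
    by eventually_elim (use \<open>0 < e\<close> in \<open>auto intro!: bexI[of _ "{}"]\<close>)
qed

lemma tends_in_prob_filterlim:
  assumes "tends_in_prob M Y c G" "filterlim f G H"
  shows "tends_in_prob M (\<lambda>k. Y (f k)) c H"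
  unfolding tends_in_prob_def
  by (intro allI impI eventually_compose_filterlim[OF _ assms(2)] tends_in_probD[OF assms(1)])

lemma tends_in_prob_cong:
  assumes "tends_in_prob M Y c G" "\<forall>\<^sub>F k in G. \<forall>\<omega>\<in>space M. Z k \<omega> = Y k \<omega>"
  shows "tends_in_prob M Z c G"
  unfolding tends_in_prob_def
proof (intro allI impI)
  fix S and e :: real assume "open S" "c \<in> S" "0 < e"
  from tends_in_probD[OF assms(1) this] assms(2)
  show "\<forall>\<^sub>F k in G. \<exists>A\<in>sets M. measure M A < e \<and> (\<forall>\<omega>\<in>space M - A. Z k \<omega> \<in> S)"
    by eventually_elim force
qed

lemma tends_in_prob_continuous:
  assumes "tends_in_prob M Y c G" "isCont h c"
  shows "tends_in_prob M (\<lambda>k \<omega>. h (Y k \<omega>)) (h c) G"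
  unfolding tends_in_prob_def
proof (intro allI impI)
  fix S and e :: real assume S: "open S" "h c \<in> S" and e: "0 < e"
  obtain S' where S': "open S'" "c \<in> S'" "\<forall>y\<in>S'. h y \<in> S"
    using assms(2) S unfolding continuous_at_open by blast
  from tends_in_probD[OF assms(1) S'(1,2) e]
  show "\<forall>\<^sub>F k in G. \<exists>A\<in>sets M. measure M A < e \<and> (\<forall>\<omega>\<in>space M - A. h (Y k \<omega>) \<in> S)"
    by eventually_elim (use S'(3) in blast)
qed

lemma tends_in_prob_Pair:
  assumes "prob_space M" "tends_in_prob M Y c G" "tends_in_prob M Z d G"
  shows "tends_in_prob M (\<lambda>k \<omega>. (Y k \<omega>, Z k \<omega>)) (c, d) G"
  unfolding tends_in_prob_def
proof (intro allI impI)
  interpret prob_space M by fact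
  fix S and e :: real assume S: "open S" "(c, d) \<in> S" and e: "0 < e"
  obtain S1 S2 where S12: "open S1" "open S2" "c \<in> S1" "d \<in> S2" "S1 \<times> S2 \<subseteq> S"
    using S by (elim open_prod_elim) auto
  have e2: "0 < e / 2" using e by simp
  from tends_in_probD[OF assms(2) S12(1,3) e2] tends_in_probD[OF assms(3) S12(2,4) e2]
  show "\<forall>\<^sub>F k in G. \<exists>A\<in>sets M. measure M A < e \<and> (\<forall>\<omega>\<in>space M - A. (Y k \<omega>, Z k \<omega>) \<in> S)"
  proof eventually_elim
    case (elim k)
    then obtain A B where
      AB: "A \<in> sets M" "B \<in> sets M" "measure M A < e / 2" "measure M B < e / 2"
        "\<forall>\<omega>\<in>space M - A. Y k \<omega> \<in> S1" "\<forall>\<omega>\<in>space M - B. Z k \<omega> \<in> S2" by blast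
    have "measure M (A \<union> B) < e"
      using measure_Un_le[OF AB(1,2)] AB(3,4) by linarith
    with AB S12(5) show ?case by (intro bexI[of _ "A \<union> B"]) auto
  qed
qed

lemma tends_in_prob_L1:
  fixes Y :: "'k \<Rightarrow> 'w \<Rightarrow> real"
  assumes "prob_space M" "\<forall>\<^sub>F k in G. integrable M (Y k)"
    and lim: "((\<lambda>k. \<integral>\<omega>. \<bar>Y k \<omega> - c\<bar> \<partial>M) \<longlongrightarrow> 0) G"
  shows "tends_in_prob M Y c G"
  unfolding tends_in_prob_def
proof (intro allI impI)
  interpret prob_space M by fact
  fix S and e :: real assume S: "open S" "c \<in> S" and e: "0 < e"
  obtain d where d: "0 < d" "\<And>y. \<bar>y - c\<bar> < d \<Longrightarrow> y \<in> S"
    using S unfolding open_dist dist_real_def by blast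
  have "\<forall>\<^sub>F k in G. (\<integral>\<omega>. \<bar>Y k \<omega> - c\<bar> \<partial>M) < e * d"
    using lim by (rule order_tendstoD) (use e d in simp)
  with assms(2)
  show "\<forall>\<^sub>F k in G. \<exists>A\<in>sets M. measure M A < e \<and> (\<forall>\<omega>\<in>space M - A. Y k \<omega> \<in> S)"
  proof eventually_elim
    case (elim k)
    note [measurable] = borel_measurable_integrable[OF elim(1)]
    let ?A = "{\<omega> \<in> space M. d \<le> \<bar>Y k \<omega> - c\<bar>}"
    have "measure M ?A \<le> (\<integral>\<omega>. \<bar>Y k \<omega> - c\<bar> \<partial>M) / d"
      by (rule integral_Markov_inequality_measure[where A = "{}"]) (use elim d in auto)
    also have "\<dots> < e" using elim(2) d by (simp add: field_simps)
    finally have "measure M ?A < e" .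
    then show ?case using d by (intro bexI[of _ ?A]) (auto simp: not_le)
  qed
qed

section \<open>Independent and identically distributed samples\<close>

text \<open>Lets one row of a doubly indexed independent family be read as an independent sequence.\<close>

lemma (in prob_space) indep_vars_reindex:
  assumes X: "indep_vars M' X I" and f: "inj_on f J" "f ` J \<subseteq> I"
  shows "indep_vars (\<lambda>j. M' (f j)) (\<lambda>j. X (f j)) J"
  unfolding indep_vars_def2
proof (intro conjI ballI)
  let ?S = "\<lambda>i. {X i -` A \<inter> space M |A. A \<in> sets (M' i)}"
  show "random_variable (M' (f j)) (X (f j))" if "j \<in> J" for j
    using X f(2) that unfolding indep_vars_def2 by blast
  have ind: "indep_sets ?S I" using X unfolding indep_vars_def2 by blast
  show "indep_sets (\<lambda>j. ?S (f j)) J"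
  proof (rule indep_setsI)
    show "?S (f j) \<subseteq> events" if "j \<in> J" for j
      using ind f(2) that unfolding indep_sets_def by blast
    fix A K assume K: "K \<noteq> {}" "K \<subseteq> J" "finite K" and A: "\<forall>j\<in>K. A j \<in> ?S (f j)"
    have inj: "inj_on f K" using f(1) K(2) by (rule inj_on_subset)
    let ?A = "\<lambda>i. A (the_inv_into K f i)"
    have "prob (\<Inter>i\<in>f ` K. ?A i) = (\<Prod>i\<in>f ` K. prob (?A i))"
      using K f(2) A inj by (intro indep_setsD[OF ind]) (auto simp: the_inv_into_f_f)
    then show "prob (\<Inter>j\<in>K. A j) = (\<Prod>j\<in>K. prob (A j))"
      using inj by (simp add: prod.reindex the_inv_into_f_f)
  qed
qed

text \<open>The common law is always accessed through \<open>Y 1\<close>: every moment of the sample is then an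
  expectation over \<open>M\<close>. Indices start at 1, as in the sample statistics.\<close>

locale iid_sample = prob_space M for M :: "'w measure" +
  fixes Y :: "nat \<Rightarrow> 'w \<Rightarrow> real"
  assumes indep: "indep_vars (\<lambda>_. borel) Y {1..}"
    and ident: "1 \<le> j \<Longrightarrow> distr M borel (Y j) = distr M borel (Y 1)"
begin

lemma rv: "1 \<le> j \<Longrightarrow> Y j \<in> borel_measurable M"
  using indep unfolding indep_vars_def2 by auto

lemma expectation_eq:
  fixes f :: "real \<Rightarrow> real"
  assumes "1 \<le> j" "f \<in> borel_measurable borel"
  shows "expectation (\<lambda>\<omega>. f (Y j \<omega>)) = expectation (\<lambda>\<omega>. f (Y 1 \<omega>))"
  using integral_distr[OF rv[OF assms(1)] assms(2)] integral_distr[OF rv[OF order_refl] assms(2)]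
  unfolding ident[OF assms(1)] by simp

lemma integrable_iff:
  fixes f :: "real \<Rightarrow> real"
  assumes "1 \<le> j" "f \<in> borel_measurable borel"
  shows "integrable M (\<lambda>\<omega>. f (Y j \<omega>)) \<longleftrightarrow> integrable M (\<lambda>\<omega>. f (Y 1 \<omega>))"
  using integrable_distr_eq[OF rv[OF assms(1)] assms(2)]
    integrable_distr_eq[OF rv[OF order_refl] assms(2)]
  unfolding ident[OF assms(1)] by simp

lemma integrable_rv: "integrable M (Y 1) \<Longrightarrow> 1 \<le> j \<Longrightarrow> integrable M (Y j)"
  by (rule integrable_iff[of j "\<lambda>x. x", THEN iffD2]) measurable

lemma integrable_rv_square:
  "integrable M (\<lambda>\<omega>. (Y 1 \<omega>)\<^sup>2) \<Longrightarrow> 1 \<le> j \<Longrightarrow> integrable M (\<lambda>\<omega>. (Y j \<omega>)\<^sup>2)"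
  by (rule integrable_iff[of j "\<lambda>x. x\<^sup>2", THEN iffD2]) measurable

lemma integrable_rv_if_square: "integrable M (\<lambda>\<omega>. (Y 1 \<omega>)\<^sup>2) \<Longrightarrow> integrable M (Y 1)"
  by (rule square_integrable_imp_integrable[OF rv[OF order_refl]])

lemma iid_sample_compose:
  assumes "f \<in> borel_measurable borel"
  shows "iid_sample M (\<lambda>j \<omega>. f (Y j \<omega>))"
proof (intro iid_sample.intro iid_sample_axioms.intro)
  show "prob_space M" by (rule prob_space_axioms)
  show "indep_vars (\<lambda>_. borel) (\<lambda>j \<omega>. f (Y j \<omega>)) {1..}"
    using indep by (rule indep_vars_compose2) (use assms in auto)
  show "distr M borel (\<lambda>\<omega>. f (Y j \<omega>)) = distr M borel (\<lambda>\<omega>. f (Y 1 \<omega>))" if "1 \<le> j" for j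
    using distr_distr[OF assms rv[OF that]] distr_distr[OF assms rv[OF order_refl]] ident[OF that]
    by (simp add: comp_def)
qed

lemma integrable_sample_mean:
  assumes "integrable M (Y 1)"
  shows "integrable M (sample_mean Y n)"
  unfolding sample_mean_def[abs_def]
  by (intro integrable_divide_zero Bochner_Integration.integrable_sum integrable_rv[OF assms]) auto

lemma integrable_mult_pair:
  assumes "integrable M (\<lambda>\<omega>. (Y 1 \<omega>)\<^sup>2)" "1 \<le> i" "1 \<le> j"
  shows "integrable M (\<lambda>\<omega>. Y i \<omega> * Y j \<omega>)"
proof (rule Bochner_Integration.integrable_bound)
  show "integrable M (\<lambda>\<omega>. (Y i \<omega>)\<^sup>2 + (Y j \<omega>)\<^sup>2)"
    by (intro Bochner_Integration.integrable_add integrable_rv_square[OF assms(1)] assms(2,3))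
  note [measurable] = rv[OF assms(2)] rv[OF assms(3)]
  show "(\<lambda>\<omega>. Y i \<omega> * Y j \<omega>) \<in> borel_measurable M" by measurable
  show "AE \<omega> in M. norm (Y i \<omega> * Y j \<omega>) \<le> norm ((Y i \<omega>)\<^sup>2 + (Y j \<omega>)\<^sup>2)"
  proof (rule AE_I2)
    fix \<omega>
    have "0 \<le> (\<bar>Y i \<omega>\<bar> - \<bar>Y j \<omega>\<bar>)\<^sup>2" by simp
    then have "2 * \<bar>Y i \<omega> * Y j \<omega>\<bar> \<le> (Y i \<omega>)\<^sup>2 + (Y j \<omega>)\<^sup>2"
      by (simp add: power2_diff abs_mult)
    then show "norm (Y i \<omega> * Y j \<omega>) \<le> norm ((Y i \<omega>)\<^sup>2 + (Y j \<omega>)\<^sup>2)"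
      by simp
  qed
qed

lemma expectation_mult_pair:
  assumes "integrable M (Y 1)" "expectation (Y 1) = 0" "1 \<le> i" "1 \<le> j"
  shows "expectation (\<lambda>\<omega>. Y i \<omega> * Y j \<omega>) = (if i = j then expectation (\<lambda>\<omega>. (Y 1 \<omega>)\<^sup>2) else 0)"
proof (cases "i = j")
  case True
  then show ?thesis
    using expectation_eq[of i "\<lambda>x. x\<^sup>2"] assms(3) by (simp add: power2_eq_square)
next
  case False
  have "indep_vars (\<lambda>_. borel) Y {i, j}"
    using indep by (rule indep_vars_subset) (use assms in auto)
  then have "expectation (\<lambda>\<omega>. \<Prod>l\<in>{i, j}. Y l \<omega>) = (\<Prod>l\<in>{i, j}. expectation (Y l))"
    by (rule indep_vars_lebesgue_integral[rotated]) (use assms integrable_rv in auto)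
  then show ?thesis
    using False expectation_eq[of i "\<lambda>x. x"] assms by simp
qed

lemma second_moment_sum_centered:
  assumes sq: "integrable M (\<lambda>\<omega>. (Y 1 \<omega>)\<^sup>2)" and z: "expectation (Y 1) = 0"
  shows "integrable M (\<lambda>\<omega>. (\<Sum>j=1..n. Y j \<omega>)\<^sup>2)"
    and "expectation (\<lambda>\<omega>. (\<Sum>j=1..n. Y j \<omega>)\<^sup>2) = real n * expectation (\<lambda>\<omega>. (Y 1 \<omega>)\<^sup>2)"
proof -
  have eq: "(\<Sum>j=1..n. Y j \<omega>)\<^sup>2 = (\<Sum>i=1..n. \<Sum>j=1..n. Y i \<omega> * Y j \<omega>)" for \<omega>
    by (simp add: power2_eq_square sum_product)
  have int: "integrable M (\<lambda>\<omega>. Y i \<omega> * Y j \<omega>)" if "i \<in> {1..n}" "j \<in> {1..n}" for i j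
    using integrable_mult_pair[OF sq] that by simp
  show "integrable M (\<lambda>\<omega>. (\<Sum>j=1..n. Y j \<omega>)\<^sup>2)"
    unfolding eq by (intro Bochner_Integration.integrable_sum int)
  have "expectation (\<lambda>\<omega>. (\<Sum>j=1..n. Y j \<omega>)\<^sup>2)
      = (\<Sum>i=1..n. expectation (\<lambda>\<omega>. \<Sum>j=1..n. Y i \<omega> * Y j \<omega>))"
    unfolding eq by (intro Bochner_Integration.integral_sum Bochner_Integration.integrable_sum int)
  also have "\<dots> = (\<Sum>i=1..n. \<Sum>j=1..n. expectation (\<lambda>\<omega>. Y i \<omega> * Y j \<omega>))"
    by (intro sum.cong refl Bochner_Integration.integral_sum int)
  also have "\<dots> = (\<Sum>i=1..n. \<Sum>j=1..n. if i = j then expectation (\<lambda>\<omega>. (Y 1 \<omega>)\<^sup>2) else 0)"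
    by (intro sum.cong refl expectation_mult_pair[OF integrable_rv_if_square[OF sq] z]) auto
  also have "\<dots> = real n * expectation (\<lambda>\<omega>. (Y 1 \<omega>)\<^sup>2)" by simp
  finally show "expectation (\<lambda>\<omega>. (\<Sum>j=1..n. Y j \<omega>)\<^sup>2) = real n * expectation (\<lambda>\<omega>. (Y 1 \<omega>)\<^sup>2)" .
qed

text \<open>The second moment of a centered mean is the variance divided by the sample size, as the mixed
  products have expectation zero, and the first absolute moment is at most the square root of the
  second one.\<close>

lemma expectation_abs_sample_mean_centered:
  assumes sq: "integrable M (\<lambda>\<omega>. (Y 1 \<omega>)\<^sup>2)" and z: "expectation (Y 1) = 0"
  shows "expectation (\<lambda>\<omega>. \<bar>sample_mean Y n \<omega>\<bar>) \<le> sqrt (expectation (\<lambda>\<omega>. (Y 1 \<omega>)\<^sup>2) / real n)"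
proof -
  let ?Z = "\<lambda>\<omega>. \<bar>sample_mean Y n \<omega>\<bar>"
  have eq: "(?Z \<omega>)\<^sup>2 = (\<Sum>j=1..n. Y j \<omega>)\<^sup>2 / (real n)\<^sup>2" for \<omega>
    by (simp add: sample_mean_def power_divide)
  have 1: "integrable M ?Z"
    using integrable_sample_mean[OF integrable_rv_if_square[OF sq]] by simp
  have 2: "integrable M (\<lambda>\<omega>. (?Z \<omega>)\<^sup>2)"
    unfolding eq using second_moment_sum_centered(1)[OF assms] by simp
  have "0 \<le> variance ?Z" by (rule variance_positive)
  then have "(expectation ?Z)\<^sup>2 \<le> expectation (\<lambda>\<omega>. (?Z \<omega>)\<^sup>2)"
    using variance_eq[OF 1 2] by simp
  also have "\<dots> = real n * expectation (\<lambda>\<omega>. (Y 1 \<omega>)\<^sup>2) / (real n)\<^sup>2"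
    unfolding eq using second_moment_sum_centered(2)[OF assms] by simp
  also have "\<dots> = expectation (\<lambda>\<omega>. (Y 1 \<omega>)\<^sup>2) / real n" by (simp add: power2_eq_square)
  finally show ?thesis by (rule real_le_rsqrt)
qed

end

text \<open>This rate serves twice: for truncated variables it yields the law of large numbers, and for the
  samples themselves it keeps the rescaled difference of the two means bounded in mean.\<close>

lemma (in iid_sample) expectation_abs_sample_mean_le:
  assumes sq: "integrable M (\<lambda>\<omega>. (Y 1 \<omega>)\<^sup>2)" and n: "1 \<le> n"
  shows "expectation (\<lambda>\<omega>. \<bar>sample_mean Y n \<omega> - expectation (Y 1)\<bar>)
    \<le> sqrt (variance (Y 1) / real n)"
proof -
  let ?m = "expectation (Y 1)"
  note i = integrable_rv_if_square[OF sq]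
  interpret C: iid_sample M "\<lambda>j \<omega>. Y j \<omega> - ?m"
    by (rule iid_sample_compose) simp
  have "expectation (\<lambda>\<omega>. \<bar>sample_mean (\<lambda>j \<omega>. Y j \<omega> - ?m) n \<omega>\<bar>) \<le> sqrt (variance (Y 1) / real n)"
    by (rule C.expectation_abs_sample_mean_centered)
       (use i sq in \<open>auto simp: prob_space power2_diff\<close>)
  moreover have "sample_mean (\<lambda>j \<omega>. Y j \<omega> - ?m) n \<omega> = sample_mean Y n \<omega> - ?m" for \<omega>
    using n by (simp add: sample_mean_def sum_subtractf field_simps)
  ultimately show ?thesis by simp
qed

text \<open>The weak law of large numbers for a single finite moment, which is all that the squared
  deviations in the sample variance have. Truncating at a high level \<open>K\<close> changes the mean and its
  expectation by little in \<open>L\<^sup>1\<close>, uniformly in the sample size, and the truncated variables are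
  bounded, so that the square root rate applies to them.\<close>

lemma (in iid_sample) sample_mean_tendsto_L1:
  assumes i: "integrable M (Y 1)"
  shows "(\<lambda>n. expectation (\<lambda>\<omega>. \<bar>sample_mean Y n \<omega> - expectation (Y 1)\<bar>)) \<longlonglongrightarrow> 0"
proof (rule LIMSEQ_I)
  fix r :: real assume r: "0 < r"
  have Y1 [measurable]: "Y 1 \<in> borel_measurable M" "Y (Suc 0) \<in> borel_measurable M"
    using rv[of 1] by simp_all
  define f :: "nat \<Rightarrow> real \<Rightarrow> real" where "f K x = x * indicator {- real K..real K} x" for K x
  have fm [measurable]: "f K \<in> borel_measurable borel" for K
    unfolding f_def by measurable
  have "(\<lambda>K. expectation (\<lambda>\<omega>. \<bar>Y 1 \<omega> - f K (Y 1 \<omega>)\<bar>)) \<longlonglongrightarrow> expectation (\<lambda>_. 0)"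
  proof (rule integral_dominated_convergence[where w = "\<lambda>\<omega>. \<bar>Y 1 \<omega>\<bar>"])
    show "AE \<omega> in M. (\<lambda>K. \<bar>Y 1 \<omega> - f K (Y 1 \<omega>)\<bar>) \<longlonglongrightarrow> 0"
    proof (rule AE_I2, rule tendsto_eventually)
      fix \<omega>
      show "\<forall>\<^sub>F K in sequentially. \<bar>Y 1 \<omega> - f K (Y 1 \<omega>)\<bar> = 0"
        using eventually_ge_at_top[of "nat \<lceil>\<bar>Y 1 \<omega>\<bar>\<rceil>"]
        by eventually_elim (auto simp: f_def indicator_def abs_le_iff nat_le_iff ceiling_le_iff)
    qed
    show "AE \<omega> in M. norm \<bar>Y 1 \<omega> - f K (Y 1 \<omega>)\<bar> \<le> \<bar>Y 1 \<omega>\<bar>" for K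
      by (auto simp: f_def indicator_def)
    show "integrable M (\<lambda>\<omega>. \<bar>Y 1 \<omega>\<bar>)" using i by simp
  qed measurable
  then have "\<forall>\<^sub>F K in sequentially. expectation (\<lambda>\<omega>. \<bar>Y 1 \<omega> - f K (Y 1 \<omega>)\<bar>) < r / 4"
    using r by (intro order_tendstoD(2)) auto
  then obtain K where K: "expectation (\<lambda>\<omega>. \<bar>Y 1 \<omega> - f K (Y 1 \<omega>)\<bar>) < r / 4"
    by (auto simp: eventually_sequentially)
  let ?m = "expectation (Y 1)" and ?mK = "expectation (\<lambda>\<omega>. f K (Y 1 \<omega>))"
  have bnd: "\<bar>f K x\<bar> \<le> real K" for x by (auto simp: f_def indicator_def)
  have fi: "integrable M (\<lambda>\<omega>. f K (Y 1 \<omega>))"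
    by (rule integrable_const_bound[where B = "real K"]) (use bnd in auto)
  have fi2: "integrable M (\<lambda>\<omega>. (f K (Y 1 \<omega>))\<^sup>2)"
    by (rule integrable_const_bound[where B = "(real K)\<^sup>2"])
       (use bnd in \<open>auto simp flip: abs_le_square_iff\<close>)
  interpret C: iid_sample M "\<lambda>j \<omega>. f K (Y j \<omega>)"
    by (rule iid_sample_compose) simp
  let ?v = "variance (\<lambda>\<omega>. f K (Y 1 \<omega>))"
  let ?T = "\<lambda>n \<omega>. \<bar>sample_mean (\<lambda>j \<omega>. f K (Y j \<omega>)) n \<omega> - ?mK\<bar>"
  let ?D = "\<lambda>j \<omega>. \<bar>Y j \<omega> - f K (Y j \<omega>)\<bar>"
  interpret D: iid_sample M ?D
    by (rule iid_sample_compose) simp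
  have iD: "integrable M (?D 1)" using i fi by simp
  have "(\<lambda>n. sqrt (?v / real n)) \<longlonglongrightarrow> sqrt 0"
    by (intro tendsto_real_sqrt tendsto_divide_0[OF tendsto_const] filterlim_at_top_imp_at_infinity
        filterlim_real_sequentially)
  then have "\<forall>\<^sub>F n in sequentially. sqrt (?v / real n) < r / 2"
    using r by (intro order_tendstoD(2)) auto
  then obtain n0 where n0: "\<And>n. n0 \<le> n \<Longrightarrow> sqrt (?v / real n) < r / 2"
    by (auto simp: eventually_sequentially)
  show "\<exists>no. \<forall>n\<ge>no. norm (expectation (\<lambda>\<omega>. \<bar>sample_mean Y n \<omega> - ?m\<bar>) - 0) < r"
  proof (intro exI[of _ "max 1 n0"] allI impI)
    fix n assume "max 1 n0 \<le> n"
    then have n: "1 \<le> n" "n0 \<le> n" by auto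
    have iT: "integrable M (?T n)"
      using C.integrable_sample_mean[OF fi, of n] by simp
    have iD': "integrable M (sample_mean ?D n)"
      by (rule D.integrable_sample_mean[OF iD])
    have iY: "integrable M (\<lambda>\<omega>. \<bar>sample_mean Y n \<omega> - ?m\<bar>)"
      using integrable_sample_mean[OF i, of n] by simp
    \<comment> \<open>The error splits into the truncated error, the mean of the cut off parts and the shift of the expectation.\<close>
    have le: "\<bar>sample_mean Y n \<omega> - ?m\<bar> \<le> ?T n \<omega> + sample_mean ?D n \<omega> + r / 4" for \<omega>
    proof -
      have "sample_mean Y n \<omega> - sample_mean (\<lambda>j \<omega>. f K (Y j \<omega>)) n \<omega>
          = (\<Sum>j=1..n. Y j \<omega> - f K (Y j \<omega>)) / real n"
        by (simp add: sample_mean_def sum_subtractf diff_divide_distrib)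
      also have "\<bar>\<dots>\<bar> \<le> sample_mean ?D n \<omega>"
        by (simp add: sample_mean_def divide_right_mono)
      finally have 1: "\<bar>sample_mean Y n \<omega> - sample_mean (\<lambda>j \<omega>. f K (Y j \<omega>)) n \<omega>\<bar>
          \<le> sample_mean ?D n \<omega>" .
      have "\<bar>?m - ?mK\<bar> = \<bar>expectation (\<lambda>\<omega>. Y 1 \<omega> - f K (Y 1 \<omega>))\<bar>"
        using i fi by simp
      also have "\<dots> \<le> expectation (?D 1)" by (rule integral_abs_bound)
      finally have "\<bar>?m - ?mK\<bar> \<le> r / 4" using K by simp
      with 1 show ?thesis by linarith
    qed
    have "expectation (\<lambda>\<omega>. \<bar>sample_mean Y n \<omega> - ?m\<bar>)
        \<le> expectation (\<lambda>\<omega>. ?T n \<omega> + sample_mean ?D n \<omega> + r / 4)"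
      by (rule integral_mono[OF iY]) (use iT iD' le in auto)
    also have "\<dots> = expectation (?T n) + expectation (sample_mean ?D n) + r / 4"
      using iT iD' by (simp add: prob_space)
    also have "expectation (sample_mean ?D n) = (\<Sum>j=1..n. expectation (?D j)) / real n"
      unfolding sample_mean_def[abs_def] using D.integrable_rv[OF iD]
      by (subst integral_divide_zero, subst Bochner_Integration.integral_sum) auto
    also have "(\<Sum>j=1..n. expectation (?D j)) = (\<Sum>j=1..n. expectation (?D 1))"
      by (intro sum.cong refl expectation_eq) auto
    also have "\<dots> / real n = expectation (?D 1)" using n by simp
    finally have "expectation (\<lambda>\<omega>. \<bar>sample_mean Y n \<omega> - ?m\<bar>)
      \<le> expectation (?T n) + expectation (?D 1) + r / 4" .
    moreover have "expectation (?T n) \<le> sqrt (?v / real n)"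
      by (rule C.expectation_abs_sample_mean_le[OF fi2 n(1)])
    ultimately have "expectation (\<lambda>\<omega>. \<bar>sample_mean Y n \<omega> - ?m\<bar>) < r"
      using K n0[OF n(2)] by linarith
    moreover have "0 \<le> expectation (\<lambda>\<omega>. \<bar>sample_mean Y n \<omega> - ?m\<bar>)"
      by (rule Bochner_Integration.integral_nonneg) simp
    ultimately show "norm (expectation (\<lambda>\<omega>. \<bar>sample_mean Y n \<omega> - ?m\<bar>) - 0) < r" by simp
  qed
qed

lemma (in iid_sample) sample_mean_tends_in_prob:
  assumes "integrable M (Y 1)"
  shows "tends_in_prob M (sample_mean Y) (expectation (Y 1)) sequentially"
  using integrable_sample_mean[OF assms] sample_mean_tendsto_L1[OF assms]
  by (intro tends_in_prob_L1) (auto intro: prob_space_axioms)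

text \<open>The sample variance is the mean of the squared deviations from the true mean, minus the squared
  error of the sample mean. The law of large numbers applies to both.\<close>

lemma (in iid_sample) sample_var_tends_in_prob:
  assumes sq: "integrable M (\<lambda>\<omega>. (Y 1 \<omega>)\<^sup>2)"
  shows "tends_in_prob M (sample_var Y) (variance (Y 1)) sequentially"
proof -
  let ?m = "expectation (Y 1)"
  note i = integrable_rv_if_square[OF sq]
  interpret C: iid_sample M "\<lambda>j \<omega>. (Y j \<omega> - ?m)\<^sup>2"
    by (rule iid_sample_compose) simp
  let ?Q = "sample_mean (\<lambda>j \<omega>. (Y j \<omega> - ?m)\<^sup>2)"
  have "tends_in_prob M ?Q (variance (Y 1)) sequentially"
    by (rule C.sample_mean_tends_in_prob) (use i sq in \<open>simp add: power2_diff\<close>)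
  note Q = tends_in_prob_Pair[OF prob_space_axioms this sample_mean_tends_in_prob[OF i]]
  have "isCont (\<lambda>p. fst p - (snd p - ?m)\<^sup>2) c" for c :: "real \<times> real"
    by (intro continuous_intros)
  from tends_in_prob_continuous[OF Q this]
  have "tends_in_prob M (\<lambda>n \<omega>. ?Q n \<omega> - (sample_mean Y n \<omega> - ?m)\<^sup>2) (variance (Y 1)) sequentially"
    by simp
  then show ?thesis
  proof (rule tends_in_prob_cong)
    show "\<forall>\<^sub>F n in sequentially. \<forall>\<omega>\<in>space M.
        sample_var Y n \<omega> = ?Q n \<omega> - (sample_mean Y n \<omega> - ?m)\<^sup>2"
      using eventually_ge_at_top[of 1]
    proof eventually_elim
      case (elim n)
      show ?case
      proof
        fix \<omega>
        define b where "b = sample_mean Y n \<omega>"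
        have b: "(\<Sum>j=1..n. Y j \<omega>) = real n * b" using elim by (simp add: b_def sample_mean_def)
        have "(\<Sum>j=1..n. (Y j \<omega> - b)\<^sup>2)
            = (\<Sum>j=1..n. (Y j \<omega> - ?m)\<^sup>2 - 2 * (b - ?m) * Y j \<omega> + (b\<^sup>2 - ?m\<^sup>2))"
          by (intro sum.cong refl) (simp add: power2_eq_square algebra_simps)
        also have "\<dots> = (\<Sum>j=1..n. (Y j \<omega> - ?m)\<^sup>2) - 2 * (b - ?m) * (\<Sum>j=1..n. Y j \<omega>)
            + real n * (b\<^sup>2 - ?m\<^sup>2)"
          by (simp add: sum.distrib sum_subtractf sum_distrib_left)
        also have "\<dots> = (\<Sum>j=1..n. (Y j \<omega> - ?m)\<^sup>2) - real n * (b - ?m)\<^sup>2"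
          unfolding b by (simp add: power2_eq_square algebra_simps)
        finally have "(\<Sum>j=1..n. (Y j \<omega> - b)\<^sup>2) / real n
            = (\<Sum>j=1..n. (Y j \<omega> - ?m)\<^sup>2) / real n - (b - ?m)\<^sup>2"
          using elim by (simp add: diff_divide_distrib)
        then show "sample_var Y n \<omega> = ?Q n \<omega> - (sample_mean Y n \<omega> - ?m)\<^sup>2"
          unfolding sample_var_def b_def
          unfolding sample_mean_def[of "\<lambda>j \<omega>. (Y j \<omega> - ?m)\<^sup>2"] .
      qed
    qed
  qed
qed

lemma (in iid_sample) unbiased_sample_var_tends_in_prob:
  assumes sq: "integrable M (\<lambda>\<omega>. (Y 1 \<omega>)\<^sup>2)"
  shows "tends_in_prob M (unbiased_sample_var Y) (variance (Y 1)) sequentially"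
proof -
  have "(\<lambda>n. real n / (real n - 1)) \<longlonglongrightarrow> 1"
  proof (rule LIMSEQ_offset[where k = 1], rule Lim_transform_eventually)
    show "(\<lambda>n. 1 + 1 / real n) \<longlonglongrightarrow> 1"
      using tendsto_add[OF tendsto_const[of 1] lim_1_over_n] by simp
    show "\<forall>\<^sub>F n in sequentially. 1 + 1 / real n = real (n + 1) / (real (n + 1) - 1)"
      using eventually_gt_at_top[of 0] by eventually_elim (simp add: field_simps)
  qed
  note P = tends_in_prob_Pair[OF prob_space_axioms tends_in_prob_const[OF this]
      sample_var_tends_in_prob[OF sq]]
  have "isCont (\<lambda>p. fst p * snd p) c" for c :: "real \<times> real"
    by (intro continuous_intros)
  from tends_in_prob_continuous[OF P this]
  show ?thesis by (simp add: unbiased_sample_var_def[abs_def])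
qed

section \<open>Characteristic functions of normalized sums\<close>

lemma exp_minus_linear_error:
  fixes x :: real
  assumes "0 \<le> x"
  shows "\<bar>exp (- x) - (1 - x)\<bar> \<le> x\<^sup>2"
proof -
  have "exp (- x) \<le> 1 / (1 + x)"
    using exp_ge_add_one_self[of x] assms by (simp add: exp_minus field_simps)
  also have "\<dots> \<le> 1 - x + x\<^sup>2"
    using assms by (simp add: field_simps power2_eq_square)
  finally show ?thesis using exp_ge_add_one_self[of "- x"] by (simp add: abs_le_iff)
qed

text \<open>The characteristic function of a centered sum, with a scaling that may vary along the sequence.
  Both the characteristic function \<open>\<phi>\<close> of \<open>Z\<close> and the Gaussian \<open>exp (- s\<^sup>2 v / 2)\<close> agree with
  \<open>1 - s\<^sup>2 v / 2\<close> up to \<open>o(s\<^sup>2)\<close>, and both have modulus at most 1, so their \<open>n\<close>-th powers at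
  \<open>s = c / sqrt n\<close> differ by at most \<open>n o(s\<^sup>2) = c\<^sup>2 o(1)\<close>. The moving scale \<open>c\<close> absorbs the sample
  fractions, which only converge.\<close>

lemma (in prob_space) char_power_tendsto:
  fixes Z :: "'a \<Rightarrow> real" and c :: "nat \<Rightarrow> real" and n :: "nat \<Rightarrow> nat"
  assumes rv: "Z \<in> borel_measurable M" and sq: "integrable M (\<lambda>\<omega>. (Z \<omega>)\<^sup>2)"
    and mean: "expectation Z = 0"
    and n: "filterlim n at_top sequentially" and c: "c \<longlonglongrightarrow> c0"
  shows "(\<lambda>k. char (distr M borel Z) (c k / sqrt (real (n k))) ^ n k)
    \<longlonglongrightarrow> complex_of_real (exp (- (c0\<^sup>2 * variance Z) / 2))"
proof -
  define v where "v = variance Z"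
  have v: "0 \<le> v" unfolding v_def by (rule variance_positive)
  have i: "integrable M Z" by (rule square_integrable_imp_integrable[OF rv sq])
  define s where "s k = c k / sqrt (real (n k))" for k
  define e where "e k = expectation (\<lambda>\<omega>. min (6 * (Z \<omega>)\<^sup>2) (\<bar>s k\<bar> * \<bar>Z \<omega>\<bar> ^ 3))" for k
  define w where "w k = exp (- ((s k)\<^sup>2 * v / 2))" for k
  interpret D: real_distribution "distr M borel Z" by (rule real_distribution_distr[OF rv])
  have sqrt_n: "filterlim (\<lambda>k. sqrt (real (n k))) at_infinity sequentially"
    by (intro filterlim_at_top_imp_at_infinity filterlim_compose[OF sqrt_at_top]
        filterlim_compose[OF filterlim_real_sequentially] n)
  have s0: "s \<longlonglongrightarrow> 0"
    unfolding s_def by (rule tendsto_divide_0[OF c sqrt_n])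
  have "e \<longlonglongrightarrow> expectation (\<lambda>_. 0)"
    unfolding e_def
  proof (rule integral_dominated_convergence[where w = "\<lambda>\<omega>. 6 * (Z \<omega>)\<^sup>2"])
    show "AE \<omega> in M. (\<lambda>k. min (6 * (Z \<omega>)\<^sup>2) (\<bar>s k\<bar> * \<bar>Z \<omega>\<bar> ^ 3)) \<longlonglongrightarrow> 0"
    proof (rule AE_I2)
      fix \<omega>
      have "(\<lambda>k. min (6 * (Z \<omega>)\<^sup>2) (\<bar>s k\<bar> * \<bar>Z \<omega>\<bar> ^ 3)) \<longlonglongrightarrow> min (6 * (Z \<omega>)\<^sup>2) (\<bar>0\<bar> * \<bar>Z \<omega>\<bar> ^ 3)"
        by (intro tendsto_intros s0)
      then show "(\<lambda>k. min (6 * (Z \<omega>)\<^sup>2) (\<bar>s k\<bar> * \<bar>Z \<omega>\<bar> ^ 3)) \<longlonglongrightarrow> 0" by simp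
    qed
  qed (use rv sq in auto)
  then have e0: "e \<longlonglongrightarrow> 0" by simp
  have bound: "cmod (char (distr M borel Z) (s k) ^ n k - complex_of_real (exp (- ((c k)\<^sup>2 * v) / 2)))
      \<le> (c k)\<^sup>2 * (e k / 6 + (s k)\<^sup>2 * v\<^sup>2 / 4)" if "0 < n k" for k
  proof -
    have ns: "real (n k) * (s k)\<^sup>2 = (c k)\<^sup>2"
      using that by (simp add: s_def power_divide)
    have "cmod (char (distr M borel Z) (s k) - (1 - (s k)\<^sup>2 * v / 2)) \<le> (s k)\<^sup>2 / 6 * e k"
      unfolding e_def using char_approx3'[OF rv i sq mean, of v] v_def by simp
    moreover have "cmod (complex_of_real (1 - (s k)\<^sup>2 * v / 2) - w k) \<le> ((s k)\<^sup>2 * v / 2)\<^sup>2"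
      unfolding w_def of_real_diff[symmetric] norm_of_real
      using exp_minus_linear_error[of "(s k)\<^sup>2 * v / 2"] v
      by (subst abs_minus_commute) simp
    ultimately have "cmod (char (distr M borel Z) (s k) - w k)
        \<le> (s k)\<^sup>2 / 6 * e k + ((s k)\<^sup>2 * v / 2)\<^sup>2"
      using norm_triangle_ineq[of "char (distr M borel Z) (s k) - (1 - (s k)\<^sup>2 * v / 2)"
          "complex_of_real (1 - (s k)\<^sup>2 * v / 2) - w k"]
      by simp
    also have "\<dots> = (s k)\<^sup>2 * (e k / 6 + (s k)\<^sup>2 * v\<^sup>2 / 4)"
      by (simp add: power2_eq_square algebra_simps)
    finally have 1: "cmod (char (distr M borel Z) (s k) - w k)
        \<le> (s k)\<^sup>2 * (e k / 6 + (s k)\<^sup>2 * v\<^sup>2 / 4)" .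
    have "cmod (char (distr M borel Z) (s k) ^ n k - complex_of_real (w k) ^ n k)
        \<le> real (n k) * cmod (char (distr M borel Z) (s k) - w k)"
      by (rule norm_power_diff) (use D.cmod_char_le_1 v in \<open>auto simp: w_def\<close>)
    also have "\<dots> \<le> real (n k) * ((s k)\<^sup>2 * (e k / 6 + (s k)\<^sup>2 * v\<^sup>2 / 4))"
      by (rule mult_left_mono[OF 1]) simp
    also have "\<dots> = (c k)\<^sup>2 * (e k / 6 + (s k)\<^sup>2 * v\<^sup>2 / 4)"
      unfolding ns[symmetric] by (simp add: mult.assoc)
    also have "complex_of_real (w k) ^ n k = complex_of_real (exp (- ((c k)\<^sup>2 * v) / 2))"
      unfolding w_def of_real_power[symmetric] exp_of_nat_mult[symmetric] ns[symmetric] by simp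
    finally show ?thesis .
  qed
  have "(\<lambda>k. (c k)\<^sup>2 * (e k / 6 + (s k)\<^sup>2 * v\<^sup>2 / 4)) \<longlonglongrightarrow> c0\<^sup>2 * (0 / 6 + 0\<^sup>2 * v\<^sup>2 / 4)"
    by (intro tendsto_intros c e0 s0) auto
  then have lim0: "(\<lambda>k. (c k)\<^sup>2 * (e k / 6 + (s k)\<^sup>2 * v\<^sup>2 / 4)) \<longlonglongrightarrow> 0" by simp
  have "\<forall>\<^sub>F k in sequentially. 0 < n k"
    by (rule eventually_compose_filterlim[OF eventually_gt_at_top n])
  then have "\<forall>\<^sub>F k in sequentially.
      cmod (char (distr M borel Z) (s k) ^ n k - complex_of_real (exp (- ((c k)\<^sup>2 * v) / 2)))
      \<le> (c k)\<^sup>2 * (e k / 6 + (s k)\<^sup>2 * v\<^sup>2 / 4)"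
    by eventually_elim (rule bound)
  from Lim_null_comparison[OF this lim0]
  have "(\<lambda>k. char (distr M borel Z) (s k) ^ n k - complex_of_real (exp (- ((c k)\<^sup>2 * v) / 2))) \<longlonglongrightarrow> 0" .
  moreover have "(\<lambda>k. complex_of_real (exp (- ((c k)\<^sup>2 * v) / 2)))
      \<longlonglongrightarrow> complex_of_real (exp (- (c0\<^sup>2 * v) / 2))"
    by (intro tendsto_intros c) auto
  ultimately have "(\<lambda>k. char (distr M borel Z) (s k) ^ n k)
      \<longlonglongrightarrow> complex_of_real (exp (- (c0\<^sup>2 * v) / 2))"
    by (rule Lim_transform[rotated])
  then show ?thesis unfolding s_def v_def .
qed

text \<open>All variables form a single independent family, indexed by sample and position, so the
  characteristic function factors over all of them at once.\<close>

lemma (in prob_space) char_sum_independent_samples: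
  fixes X :: "nat \<Rightarrow> nat \<Rightarrow> 'a \<Rightarrow> real" and c :: "nat \<Rightarrow> real"
  assumes indep: "indep_vars (\<lambda>_. borel) (\<lambda>(i, j). X i j) (S \<times> {1..})" and S: "finite S"
    and ident: "\<And>i j. i \<in> S \<Longrightarrow> 1 \<le> j \<Longrightarrow> distr M borel (X i j) = distr M borel (X i 1)"
  shows "char (distr M borel (\<lambda>\<omega>. \<Sum>i\<in>S. \<Sum>j=1..m i. c i * (X i j \<omega> - \<mu>))) t
    = (\<Prod>i\<in>S. char (distr M borel (\<lambda>\<omega>. X i 1 \<omega> - \<mu>)) (c i * t) ^ m i)"
proof -
  let ?I = "SIGMA i:S. {1..m i}"
  define Y where "Y p \<omega> = c (fst p) * (X (fst p) (snd p) \<omega> - \<mu>)" for p \<omega>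
  have rv: "X i j \<in> borel_measurable M" if "i \<in> S" "1 \<le> j" for i j
    using indep that unfolding indep_vars_def2 by fastforce
  have "indep_vars (\<lambda>_. borel) (\<lambda>(i, j). X i j) ?I"
    using indep by (rule indep_vars_subset) auto
  then have "indep_vars (\<lambda>_. borel) (\<lambda>p \<omega>. c (fst p) * ((case p of (i, j) \<Rightarrow> X i j) \<omega> - \<mu>)) ?I"
    by (rule indep_vars_compose2) auto
  then have Y: "indep_vars (\<lambda>_. borel) Y ?I"
    by (simp add: Y_def[abs_def] case_prod_beta)
  have one: "char (distr M borel (Y (i, j))) t = char (distr M borel (\<lambda>\<omega>. X i 1 \<omega> - \<mu>)) (c i * t)"
    if "i \<in> S" "1 \<le> j" for i j
  proof -
    have "char (distr M borel (Y (i, j))) t = (CLINT x|distr M borel (X i j). iexp (t * (c i * (x - \<mu>))))"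
      unfolding char_def Y_def using rv[OF that] by (simp add: integral_distr)
    also have "\<dots> = (CLINT x|distr M borel (X i 1). iexp (t * (c i * (x - \<mu>))))"
      using ident[OF that] by simp
    also have "\<dots> = char (distr M borel (\<lambda>\<omega>. X i 1 \<omega> - \<mu>)) (c i * t)"
      unfolding char_def using rv[OF that(1) order_refl] by (simp add: integral_distr mult_ac)
    finally show ?thesis .
  qed
  have "(\<Sum>i\<in>S. \<Sum>j=1..m i. c i * (X i j \<omega> - \<mu>)) = (\<Sum>p\<in>?I. Y p \<omega>)" for \<omega>
    using S by (subst sum.Sigma) (auto simp: Y_def case_prod_beta)
  then have "char (distr M borel (\<lambda>\<omega>. \<Sum>i\<in>S. \<Sum>j=1..m i. c i * (X i j \<omega> - \<mu>))) t
      = (\<Prod>p\<in>?I. char (distr M borel (Y p)) t)"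
    using char_distr_sum[OF Y] by simp
  also have "\<dots> = (\<Prod>i\<in>S. \<Prod>j=1..m i. char (distr M borel (Y (i, j))) t)"
    using S by (subst prod.Sigma) auto
  also have "\<dots> = (\<Prod>i\<in>S. \<Prod>j=1..m i. char (distr M borel (\<lambda>\<omega>. X i 1 \<omega> - \<mu>)) (c i * t))"
    by (intro prod.cong refl one) auto
  finally show ?thesis by simp
qed

text \<open>The central limit theorem for a deterministic linear combination of finitely many independent
  sample means. Sample \<open>i\<close> enters with the scale \<open>w i * sqrt (n / N i)\<close>, which tends to
  \<open>w i / sqrt (lam i)\<close> and so contributes the variance \<open>(w i)\<^sup>2 / lam i\<close> times that of one observation.\<close>

lemma (in prob_space) char_weighted_means_tendsto:
  fixes X :: "nat \<Rightarrow> nat \<Rightarrow> 'a \<Rightarrow> real" and N :: "nat \<Rightarrow> nat \<Rightarrow> nat" and w lam :: "nat \<Rightarrow> real"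
  assumes indep: "indep_vars (\<lambda>_. borel) (\<lambda>(i, j). X i j) (S \<times> {1..})" and S: "finite S"
    and iid: "\<And>i. i \<in> S \<Longrightarrow> iid_sample M (X i)"
    and sq: "\<And>i. i \<in> S \<Longrightarrow> integrable M (\<lambda>\<omega>. (X i 1 \<omega>)\<^sup>2)"
    and mean: "\<And>i. i \<in> S \<Longrightarrow> expectation (X i 1) = \<mu>"
    and N: "\<And>i. i \<in> S \<Longrightarrow> filterlim (N i) at_top sequentially"
    and frac: "\<And>i. i \<in> S \<Longrightarrow> (\<lambda>k. real (n k) / real (N i k)) \<longlonglongrightarrow> inverse (lam i)"
    and lam: "\<And>i. i \<in> S \<Longrightarrow> 0 < lam i"
  shows "(\<lambda>k. char (distr M borel (\<lambda>\<omega>. sqrt (real (n k))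
            * (\<Sum>i\<in>S. w i * (sample_mean (X i) (N i k) \<omega> - \<mu>)))) t)
    \<longlonglongrightarrow> complex_of_real (exp (- ((\<Sum>i\<in>S. (w i)\<^sup>2 * inverse (lam i) * variance (X i 1)) * t\<^sup>2) / 2))"
proof -
  define Z where "Z i \<omega> = X i 1 \<omega> - \<mu>" for i \<omega>
  define c where "c i k = w i * t * sqrt (real (n k) / real (N i k))" for i k
  have lim: "(\<lambda>k. char (distr M borel (Z i)) (c i k / sqrt (real (N i k))) ^ N i k)
      \<longlonglongrightarrow> complex_of_real (exp (- ((w i)\<^sup>2 * inverse (lam i) * variance (X i 1) * t\<^sup>2) / 2))"
    if i: "i \<in> S" for i
  proof -
    interpret iid_sample M "X i" by (rule iid[OF i])
    have int: "integrable M (X i 1)" by (rule integrable_rv_if_square[OF sq[OF i]])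
    have EZ: "expectation (Z i) = 0"
      unfolding Z_def using int mean[OF i] by (simp add: prob_space)
    have "variance (Z i) = variance (X i 1)"
      unfolding EZ mean[OF i] by (simp add: Z_def)
    moreover have "(w i * t * sqrt (inverse (lam i)))\<^sup>2 = (w i)\<^sup>2 * inverse (lam i) * t\<^sup>2"
      using lam[OF i] by (simp add: power_mult_distrib)
    moreover have "(\<lambda>k. char (distr M borel (Z i)) (c i k / sqrt (real (N i k))) ^ N i k)
      \<longlonglongrightarrow> complex_of_real (exp (- ((w i * t * sqrt (inverse (lam i)))\<^sup>2 * variance (Z i)) / 2))"
    proof (rule char_power_tendsto)
      show "Z i \<in> borel_measurable M"
        unfolding Z_def using rv[of 1] by measurable
      show "integrable M (\<lambda>\<omega>. (Z i \<omega>)\<^sup>2)"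
        unfolding Z_def power2_diff using int sq[OF i] by simp
      show "c i \<longlonglongrightarrow> w i * t * sqrt (inverse (lam i))"
        unfolding c_def by (intro tendsto_intros frac i)
    qed (rule EZ N[OF i])+
    ultimately show ?thesis by (simp add: mult_ac)
  qed
  have "\<forall>\<^sub>F k in sequentially. \<forall>i\<in>S. 1 \<le> N i k"
    using S N by (intro eventually_ball_finite ballI) (simp_all add: filterlim_at_top)
  then have "\<forall>\<^sub>F k in sequentially.
      (\<Prod>i\<in>S. char (distr M borel (Z i)) (c i k / sqrt (real (N i k))) ^ N i k)
      = char (distr M borel (\<lambda>\<omega>. sqrt (real (n k))
            * (\<Sum>i\<in>S. w i * (sample_mean (X i) (N i k) \<omega> - \<mu>)))) t"
  proof eventually_elim
    case (elim k)
    have "sqrt (real (n k)) * (\<Sum>i\<in>S. w i * (sample_mean (X i) (N i k) \<omega> - \<mu>))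
        = (\<Sum>i\<in>S. \<Sum>j=1..N i k. (w i * sqrt (real (n k)) / real (N i k)) * (X i j \<omega> - \<mu>))" for \<omega>
      unfolding sum_distrib_left
    proof (rule sum.cong[OF refl])
      fix i assume "i \<in> S"
      then have "1 \<le> N i k" using elim by blast
      then have "sample_mean (X i) (N i k) \<omega> - \<mu> = (\<Sum>j=1..N i k. X i j \<omega> - \<mu>) / real (N i k)"
        by (simp add: sample_mean_def sum_subtractf diff_divide_distrib)
      then show "sqrt (real (n k)) * (w i * (sample_mean (X i) (N i k) \<omega> - \<mu>))
          = (\<Sum>j=1..N i k. (w i * sqrt (real (n k)) / real (N i k)) * (X i j \<omega> - \<mu>))"
        unfolding sum_distrib_left[symmetric] by simp
    qed
    moreover have "(w i * sqrt (real (n k)) / real (N i k)) * t = c i k / sqrt (real (N i k))" for i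
      by (simp add: c_def real_sqrt_divide)
    ultimately show ?case
      using char_sum_independent_samples[OF indep S iid_sample.ident[OF iid],
          where c = "\<lambda>i. w i * sqrt (real (n k)) / real (N i k)" and m = "\<lambda>i. N i k" and \<mu> = \<mu> and t = t]
      by (simp add: Z_def[abs_def])
  qed
  moreover have "(\<lambda>k. \<Prod>i\<in>S. char (distr M borel (Z i)) (c i k / sqrt (real (N i k))) ^ N i k)
    \<longlonglongrightarrow> (\<Prod>i\<in>S. complex_of_real (exp (- ((w i)\<^sup>2 * inverse (lam i) * variance (X i 1) * t\<^sup>2) / 2)))"
    by (intro tendsto_prod lim)
  moreover have "(\<Prod>i\<in>S. complex_of_real (exp (- ((w i)\<^sup>2 * inverse (lam i) * variance (X i 1) * t\<^sup>2) / 2)))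
     = complex_of_real (exp (- ((\<Sum>i\<in>S. (w i)\<^sup>2 * inverse (lam i) * variance (X i 1)) * t\<^sup>2) / 2))"
    unfolding of_real_prod[symmetric] exp_sum[OF S, symmetric]
    by (simp add: sum_distrib_right sum_divide_distrib sum_negf)
  ultimately show ?thesis by (simp add: Lim_transform_eventually)
qed

section \<open>From characteristic functions to convergence in distribution\<close>

text \<open>Slutsky's theorem at the level of characteristic functions. On the event where \<open>U k\<close> is small,
  \<open>\<bar>exp (\<i> t U W) - 1\<bar> \<le> \<bar>t\<bar> \<bar>U\<bar> \<bar>W\<bar>\<close> is small in mean because \<open>W\<close> is bounded in \<open>L\<^sup>1\<close>; elsewhere the
  integrand is at most 2 and the probability is small.\<close>

lemma (in prob_space) char_distr_Slutsky:
  fixes A T U W :: "nat \<Rightarrow> 'a \<Rightarrow> real"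
  assumes T: "\<forall>\<^sub>F k in sequentially. T k \<in> borel_measurable M"
    and A: "\<And>k. A k \<in> borel_measurable M"
    and W: "\<And>k. integrable M (W k)" and C: "\<forall>\<^sub>F k in sequentially. expectation (\<lambda>\<omega>. \<bar>W k \<omega>\<bar>) \<le> C"
    and eq: "\<And>k \<omega>. T k \<omega> = A k \<omega> + U k \<omega> * W k \<omega>"
    and U: "tends_in_prob M U 0 sequentially"
  shows "(\<lambda>k. char (distr M borel (T k)) t - char (distr M borel (A k)) t) \<longlonglongrightarrow> 0"
proof (rule tendstoI)
  fix r :: real assume r: "0 < r"
  \<comment> \<open>Small enough for the first part to cost at most half of \<open>r\<close>; the 1 avoids a zero denominator.\<close>
  define d where "d = r / (2 * (\<bar>t\<bar> * \<bar>C\<bar> + 1))"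
  have d0: "0 < d" using r by (simp add: d_def add_nonneg_pos)
  have "\<bar>t\<bar> * \<bar>C\<bar> * d \<le> (\<bar>t\<bar> * \<bar>C\<bar> + 1) * d" using d0 by simp
  also have "\<dots> = r / 2"
    using add_nonneg_pos[of "\<bar>t\<bar> * \<bar>C\<bar>" 1] by (simp add: d_def field_simps)
  finally have d: "\<bar>t\<bar> * \<bar>C\<bar> * d \<le> r / 2" .
  from tends_in_probD[OF U, of "ball 0 d" "r / 4"] d0 r
  have "\<forall>\<^sub>F k in sequentially. \<exists>B\<in>events. prob B < r / 4 \<and> (\<forall>\<omega>\<in>space M - B. U k \<omega> \<in> ball 0 d)"
    by simp
  with T C
  show "\<forall>\<^sub>F k in sequentially. dist (char (distr M borel (T k)) t - char (distr M borel (A k)) t) 0 < r"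
  proof eventually_elim
    case (elim k)
    then obtain B where B: "B \<in> events" "prob B < r / 4" "\<forall>\<omega>\<in>space M - B. U k \<omega> \<in> ball 0 d"
      by blast
    note [measurable] = elim(1) A[of k] borel_measurable_integrable[OF W[of k]]
    have iT: "integrable M (\<lambda>\<omega>. iexp (t * T k \<omega>))"
      by (rule integrable_const_bound[where B = 1]) auto
    have iA: "integrable M (\<lambda>\<omega>. iexp (t * A k \<omega>))"
      by (rule integrable_const_bound[where B = 1]) auto
    have iR: "integrable M (\<lambda>\<omega>. 2 * indicator B \<omega> + \<bar>t\<bar> * d * \<bar>W k \<omega>\<bar>)"
      using W[of k] B(1) by (intro Bochner_Integration.integrable_add integrable_mult_right
        integrable_abs integrable_real_indicator) (auto simp: emeasure_eq_measure)
    have pt: "cmod (iexp (t * T k \<omega>) - iexp (t * A k \<omega>)) \<le> 2 * indicator B \<omega> + \<bar>t\<bar> * d * \<bar>W k \<omega>\<bar>"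
      if "\<omega> \<in> space M" for \<omega>
    proof (cases "\<omega> \<in> B")
      case True
      have "cmod (iexp (t * T k \<omega>) - iexp (t * A k \<omega>)) \<le> 1 + 1"
        using norm_triangle_ineq4[of "iexp (t * T k \<omega>)" "iexp (t * A k \<omega>)"] by simp
      moreover have "0 \<le> \<bar>t\<bar> * d * \<bar>W k \<omega>\<bar>" using d0 by simp
      ultimately show ?thesis using True by simp
    next
      case False
      then have u: "\<bar>U k \<omega>\<bar> \<le> d" using B(3) that by (auto simp: dist_real_def intro!: less_imp_le)
      let ?x = "t * (U k \<omega> * W k \<omega>)"
      have "iexp (t * T k \<omega>) - iexp (t * A k \<omega>) = iexp (t * A k \<omega>) * (iexp ?x - 1)"
        unfolding eq by (simp add: distrib_left exp_add right_diff_distrib)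
      then have "cmod (iexp (t * T k \<omega>) - iexp (t * A k \<omega>)) = cmod (iexp ?x - 1)"
        by (simp add: norm_mult)
      also have "\<dots> \<le> \<bar>?x\<bar>" using iexp_approx1[of ?x 0] by simp
      also have "\<dots> = \<bar>t\<bar> * \<bar>U k \<omega>\<bar> * \<bar>W k \<omega>\<bar>" by (simp add: abs_mult)
      also have "\<dots> \<le> \<bar>t\<bar> * d * \<bar>W k \<omega>\<bar>"
        by (intro mult_right_mono mult_left_mono u) auto
      finally show ?thesis using False by simp
    qed
    have "char (distr M borel (T k)) t - char (distr M borel (A k)) t
        = (CLINT \<omega>|M. iexp (t * T k \<omega>) - iexp (t * A k \<omega>))"
      using iT iA by (simp add: char_def integral_distr)
    also have "cmod \<dots> \<le> expectation (\<lambda>\<omega>. cmod (iexp (t * T k \<omega>) - iexp (t * A k \<omega>)))"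
      by (rule integral_norm_bound)
    also have "\<dots> \<le> expectation (\<lambda>\<omega>. 2 * indicator B \<omega> + \<bar>t\<bar> * d * \<bar>W k \<omega>\<bar>)"
      by (rule integral_mono[OF _ iR pt]) (use iT iA in auto)
    also have "\<dots> = 2 * prob B + \<bar>t\<bar> * d * expectation (\<lambda>\<omega>. \<bar>W k \<omega>\<bar>)"
      using W[of k] B(1) by (subst Bochner_Integration.integral_add) (auto simp: emeasure_eq_measure)
    also have "\<bar>t\<bar> * d * expectation (\<lambda>\<omega>. \<bar>W k \<omega>\<bar>) \<le> \<bar>t\<bar> * d * \<bar>C\<bar>"
      using elim(2) d0 by (intro mult_left_mono) auto
    also have "\<dots> \<le> r / 2" using d by (simp add: mult_ac)
    also have "2 * prob B + r / 2 < r" using B(2) by simp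
    finally show ?case by (simp add: dist_norm)
  qed
qed

text \<open>The laws of the estimator need to be probability measures only once both sample sizes are
  positive, hence this version of the continuity theorem.\<close>

lemma levy_continuity_eventually:
  fixes L :: "nat \<Rightarrow> real measure"
  assumes "\<forall>\<^sub>F k in sequentially. real_distribution (L k)" "real_distribution L'"
    and "\<And>t. (\<lambda>k. char (L k) t) \<longlonglongrightarrow> char L' t"
  shows "weak_conv_m L L'"
proof -
  obtain K where K: "\<And>k. K \<le> k \<Longrightarrow> real_distribution (L k)"
    using assms(1) by (auto simp: eventually_sequentially)
  have "weak_conv_m (\<lambda>k. L (k + K)) L'"
    by (rule levy_continuity) (use K assms(2) LIMSEQ_ignore_initial_segment[OF assms(3)] in auto)
  then show ?thesis
    unfolding weak_conv_m_def weak_conv_def by (auto intro: LIMSEQ_offset[where k = K])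
qed

text \<open>Scaling a standard normal variable by \<open>sqrt v\<close> covers the point mass at \<open>v = 0\<close> as well, so the
  characteristic function needs no case distinction.\<close>

lemma normal_law_eq_distr:
  assumes "0 \<le> v"
  shows "normal_law 0 v = distr std_normal_distribution borel (\<lambda>x. sqrt v * x)"
proof (cases "v = 0")
  case True
  interpret real_distribution std_normal_distribution by (rule real_dist_normal_dist)
  show ?thesis using True distr_const[of 0 borel] by (simp add: normal_law_def)
next
  case False
  interpret real_distribution std_normal_distribution by (rule real_dist_normal_dist)
  have "distr std_normal_distribution lborel (\<lambda>x. x) = std_normal_distribution"
    by (rule distr_id2) simp
  then have "distributed std_normal_distribution lborel (\<lambda>x. x) std_normal_density"
    by (simp add: distributed_def)
  from normal_density_affine[OF this, of "sqrt v" 0] False assms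
  have "distributed std_normal_distribution lborel (\<lambda>x. sqrt v * x) (normal_density 0 (sqrt v))"
    by simp
  then have "density lborel (normal_density 0 (sqrt v))
      = distr std_normal_distribution lborel (\<lambda>x. sqrt v * x)"
    by (simp add: distributed_def)
  also have "\<dots> = distr std_normal_distribution borel (\<lambda>x. sqrt v * x)"
    by (rule distr_cong) auto
  finally show ?thesis using False by (simp add: normal_law_def)
qed

lemma real_distribution_normal_law: "0 \<le> v \<Longrightarrow> real_distribution (normal_law 0 v)"
proof -
  interpret real_distribution std_normal_distribution by (rule real_dist_normal_dist)
  show "0 \<le> v \<Longrightarrow> ?thesis"
    unfolding normal_law_eq_distr by (rule real_distribution_distr) simp
qed

lemma char_normal_law:
  assumes "0 \<le> v"
  shows "char (normal_law 0 v) t = complex_of_real (exp (- (v * t\<^sup>2) / 2))"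
proof -
  have "char (normal_law 0 v) t = char std_normal_distribution (t * sqrt v)"
    unfolding normal_law_eq_distr[OF assms] char_def by (simp add: integral_distr mult.assoc)
  then show ?thesis
    using assms by (simp add: char_std_normal_distribution power_mult_distrib mult.commute)
qed

section \<open>The random weight\<close>

text \<open>A function glued along \<open>a = b\<close> is continuous off the seam because one branch is chosen on a whole
  neighbourhood, and on the seam if the branches agree there.\<close>

lemma isCont_if_le:
  fixes a b :: "'a::t2_space \<Rightarrow> real" and f h :: "'a \<Rightarrow> 'b::t2_space"
  assumes ab: "isCont a c" "isCont b c" and fh: "isCont f c" "isCont h c"
    and tie: "a c = b c \<Longrightarrow> f c = h c"
  shows "isCont (\<lambda>x. if a x \<le> b x then f x else h x) c"
proof -
  have a: "(a \<longlongrightarrow> a c) (nhds c)" and b: "(b \<longlongrightarrow> b c) (nhds c)"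
    and f: "(f \<longlongrightarrow> f c) (nhds c)" and h: "(h \<longlongrightarrow> h c) (nhds c)"
    using ab fh by (simp_all add: isCont_def tendsto_nhds_iff)
  have diff: "((\<lambda>x. b x - a x) \<longlongrightarrow> b c - a c) (nhds c)"
    by (intro tendsto_diff a b)
  consider "a c < b c" | "b c < a c" | "a c = b c" by linarith
  then have "((\<lambda>x. if a x \<le> b x then f x else h x) \<longlongrightarrow> (if a c \<le> b c then f c else h c)) (nhds c)"
  proof cases
    case 1
    have "\<forall>\<^sub>F x in nhds c. 0 < b x - a x"
      using diff by (rule order_tendstoD) (use 1 in simp)
    then have "\<forall>\<^sub>F x in nhds c. f x = (if a x \<le> b x then f x else h x)"
      by eventually_elim simp
    with f have "((\<lambda>x. if a x \<le> b x then f x else h x) \<longlongrightarrow> f c) (nhds c)"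
      by (rule Lim_transform_eventually)
    with 1 show ?thesis by simp
  next
    case 2
    have "\<forall>\<^sub>F x in nhds c. b x - a x < 0"
      using diff by (rule order_tendstoD) (use 2 in simp)
    then have "\<forall>\<^sub>F x in nhds c. h x = (if a x \<le> b x then f x else h x)"
      by eventually_elim simp
    with h have "((\<lambda>x. if a x \<le> b x then f x else h x) \<longlongrightarrow> h c) (nhds c)"
      by (rule Lim_transform_eventually)
    with 2 show ?thesis by simp
  next
    case 3
    show ?thesis
    proof (rule topological_tendstoI)
      fix S assume S: "open S" "(if a c \<le> b c then f c else h c) \<in> S"
      then have "f c \<in> S" "h c \<in> S" using 3 tie by (auto split: if_splits)
      then show "\<forall>\<^sub>F x in nhds c. (if a x \<le> b x then f x else h x) \<in> S"
        using topological_tendstoD[OF f S(1)] topological_tendstoD[OF h S(1)]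
        by (auto elim: eventually_elim2)
    qed
  qed
  then show ?thesis by (simp add: isCont_def tendsto_nhds_iff)
qed

lemma Ck_on_imp_continuous_on: "Ck_on k f U \<Longrightarrow> continuous_on U f"
  by (cases k) (auto intro: differentiable_imp_continuous_on)

text \<open>The weight functions are controlled on \<open>U\<close> only; the arguments stay in \<open>weight_range\<close>, so the weight
  equals the one formed from the functions cut off outside of \<open>U\<close>, which are Borel.\<close>

lemma random_weight_measurable:
  assumes n: "1 \<le> n1" "1 \<le> n2"
    and V: "V (X 1) n1 \<in> borel_measurable M" "V (X 2) n2 \<in> borel_measurable M"
    and V0: "\<And>\<omega>. 0 \<le> V (X 1) n1 \<omega>" "\<And>\<omega>. 0 \<le> V (X 2) n2 \<omega>"
    and mean: "sample_mean (X 1) n1 \<in> borel_measurable M" "sample_mean (X 2) n2 \<in> borel_measurable M"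
    and U: "open U" "weight_range \<subseteq> U" "continuous_on U gle" "continuous_on U ggt"
  shows "random_weight V gle ggt X n1 n2 \<in> borel_measurable M"
proof -
  define args where "args \<omega> = (real n1 / real (n1 + n2), real n2 / real (n1 + n2),
    V (X 1) n1 \<omega>, V (X 2) n2 \<omega>, sample_mean (X 1) n1 \<omega>, sample_mean (X 2) n2 \<omega>)" for \<omega>
  note [measurable] = V mean
  have args [measurable]: "args \<in> borel_measurable M"
    unfolding args_def by (intro borel_measurable_Pair) measurable
  have U_args: "args \<omega> \<in> U" for \<omega>
    using U(2) n V0 by (force simp: args_def weight_range_def)
  have f_args: "(\<lambda>\<omega>. f (args \<omega>)) \<in> borel_measurable M"
    if "continuous_on U f" for f :: "weight_args \<Rightarrow> real"
    using measurable_compose[OF args borel_measurable_continuous_on_indicator[OF _ that]] U(1)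
    by (simp add: U_args)
  note [measurable] = f_args[OF U(3)] f_args[OF U(4)]
  have "random_weight V gle ggt X n1 n2
      = (\<lambda>\<omega>. if V (X 1) n1 \<omega> \<le> V (X 2) n2 \<omega> then gle (args \<omega>) else ggt (args \<omega>))"
    by (simp add: fun_eq_iff random_weight_def args_def Let_def)
  also have "\<dots> \<in> borel_measurable M" by measurable
  finally show ?thesis .
qed

text \<open>The weight is one fixed function of its six arguments, continuous at their limit: off the tie by
  the choice of a single branch, at a tie because both branches take the value \<open>g\<close>.\<close>

lemma random_weight_tends_in_prob:
  fixes N :: "nat \<Rightarrow> 'k \<Rightarrow> nat"
  assumes M: "prob_space M"
    and frac: "((\<lambda>k. real (N 1 k) / real (N 1 k + N 2 k)) \<longlongrightarrow> l1) G"
      "((\<lambda>k. real (N 2 k) / real (N 1 k + N 2 k)) \<longlongrightarrow> l2) G"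
    and V: "tends_in_prob M (\<lambda>k. V (X 1) (N 1 k)) v1 G" "tends_in_prob M (\<lambda>k. V (X 2) (N 2 k)) v2 G"
    and mean: "tends_in_prob M (\<lambda>k. sample_mean (X 1) (N 1 k)) m G"
      "tends_in_prob M (\<lambda>k. sample_mean (X 2) (N 2 k)) m G"
    and cont: "isCont gle (l1, l2, v1, v2, m, m)" "isCont ggt (l1, l2, v1, v2, m, m)"
    and tie: "v1 = v2 \<Longrightarrow> gle (l1, l2, v1, v2, m, m) = g \<and> ggt (l1, l2, v1, v2, m, m) = g"
    and g: "g = limit_weight gle ggt l1 l2 v1 v2 m"
  shows "tends_in_prob M (\<lambda>k. random_weight V gle ggt X (N 1 k) (N 2 k)) g G"
proof -
  let ?\<theta> = "(l1, l2, v1, v2, m, m)"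
  define h :: "weight_args \<Rightarrow> real"
    where "h = (\<lambda>p. if fst (snd (snd p)) \<le> fst (snd (snd (snd p))) then gle p else ggt p)"
  have h: "isCont h ?\<theta>"
    unfolding h_def by (rule isCont_if_le) (use cont tie in \<open>auto intro!: continuous_intros\<close>)
  have hg: "h ?\<theta> = g"
    using tie g by (cases v1 v2 rule: linorder_cases) (auto simp: h_def limit_weight_def)
  note tends_in_prob_continuous[OF tends_in_prob_Pair[OF M tends_in_prob_const[OF frac(1)]
    tends_in_prob_Pair[OF M tends_in_prob_const[OF frac(2)] tends_in_prob_Pair[OF M V(1)
    tends_in_prob_Pair[OF M V(2) tends_in_prob_Pair[OF M mean]]]]] h]
  then have "tends_in_prob M (\<lambda>k \<omega>. h (real (N 1 k) / real (N 1 k + N 2 k),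
      real (N 2 k) / real (N 1 k + N 2 k), V (X 1) (N 1 k) \<omega>, V (X 2) (N 2 k) \<omega>,
      sample_mean (X 1) (N 1 k) \<omega>, sample_mean (X 2) (N 2 k) \<omega>)) g G"
    unfolding hg .
  then show ?thesis
    by (rule tends_in_prob_cong) (simp add: h_def random_weight_def Let_def)
qed

section \<open>The central limit theorem for the common mean estimator\<close>

theorem theorem4p2:
  fixes M :: "'w measure"
    and X :: "nat \<Rightarrow> nat \<Rightarrow> 'w \<Rightarrow> real"
    and F :: "nat \<Rightarrow> real measure"
    and N :: "nat \<Rightarrow> nat \<Rightarrow> nat"
    and lam var :: "nat \<Rightarrow> real"
    and \<mu> g :: real
    and gle ggt :: "weight_args \<Rightarrow> real"
    and U :: "weight_args set"
  assumes "prob_space M"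
    and indep: "prob_space.indep_vars M (\<lambda>_. borel) (\<lambda>(i, j). X i j) ({1, 2} \<times> {1..})"
    and distributed: "\<And>i j. i \<in> {1, 2} \<Longrightarrow> j \<ge> 1 \<Longrightarrow> distr M borel (X i j) = F i"
    and finite_variance: "\<And>i. i \<in> {1, 2} \<Longrightarrow> integrable (F i) (\<lambda>x. x\<^sup>2)"
    and common_mean: "\<And>i. i \<in> {1, 2} \<Longrightarrow> prob_space.expectation M (X i 1) = \<mu>"
    and variance: "\<And>i. i \<in> {1, 2} \<Longrightarrow> var i = prob_space.variance M (X i 1)"
    and sizes: "filterlim (\<lambda>k. min (N 1 k) (N 2 k)) at_top sequentially"
    and fractions: "\<And>i. i \<in> {1, 2} \<Longrightarrow>
          (\<lambda>k. real (N i k) / real (N 1 k + N 2 k)) \<longlonglongrightarrow> lam i"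
    and lam: "\<And>i. i \<in> {1, 2} \<Longrightarrow> lam i \<in> {0<..<1}"
    and U: "open U" "weight_range \<subseteq> U"
    and smooth: "Ck_on 3 gle U" "Ck_on 3 ggt U"
    and bounded: "bounded_third_partials_on gle U" "bounded_third_partials_on ggt U"
    and g: "g = limit_weight gle ggt (lam 1) (lam 2) (var 1) (var 2) \<mu>"
    and tie: "var 1 = var 2 \<Longrightarrow>
          gle (lam 1, lam 2, var 1, var 2, \<mu>, \<mu>) = g \<and> ggt (lam 1, lam 2, var 1, var 2, \<mu>, \<mu>) = g"
  shows "\<forall>V \<in> {unbiased_sample_var, sample_var}.
    weak_conv_m
      (\<lambda>k. distr M borel (\<lambda>\<omega>. sqrt (real (N 1 k + N 2 k)) *
             (common_mean_estimator V gle ggt X (N 1 k) (N 2 k) \<omega> - \<mu>)))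
      (normal_law 0 (asymptotic_var g (lam 1) (lam 2) (var 1) (var 2)))"
proof
  interpret prob_space M by fact
  have iid: "iid_sample M (X i)" if i: "i \<in> {1, 2}" for i
  proof (intro iid_sample.intro iid_sample_axioms.intro)
    show "prob_space M" by fact
    show "indep_vars (\<lambda>_. borel) (X i) {1..}"
      using indep_vars_reindex[OF indep, of "\<lambda>j. (i, j)" "{1..}"] i by (auto simp: inj_on_def)
    show "distr M borel (X i j) = distr M borel (X i 1)" if "1 \<le> j" for j
      using distributed[OF i that] distributed[OF i order_refl] by simp
  qed
  have rv: "X i j \<in> borel_measurable M" if "i \<in> {1, 2}" "1 \<le> j" for i j
    using iid_sample.rv[OF iid] that by blast
  have sq: "integrable M (\<lambda>\<omega>. (X i 1 \<omega>)\<^sup>2)" if i: "i \<in> {1, 2}" for i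
  proof -
    have "integrable (distr M borel (X i 1)) (\<lambda>x. x\<^sup>2)"
      using finite_variance[OF i] distributed[OF i order_refl] by simp
    then show ?thesis
      by (subst (asm) integrable_distr_eq[OF rv[OF i order_refl]]) simp_all
  qed
  have int: "integrable M (X i 1)" if "i \<in> {1, 2}" for i
    using iid_sample.integrable_rv_if_square[OF iid sq] that by blast
  have N: "filterlim (N i) at_top sequentially" if "i \<in> {1, 2}" for i
    by (rule filterlim_at_top_mono[OF sizes]) (use that in auto)
  define n where "n k = N 1 k + N 2 k" for k
  have ratio: "(\<lambda>k. real (n k) / real (N i k)) \<longlonglongrightarrow> inverse (lam i)" if "i \<in> {1, 2}" for i
    using tendsto_inverse[OF fractions[OF that]] lam[OF that] by (simp add: n_def)
  have mean: "tends_in_prob M (\<lambda>k. sample_mean (X i) (N i k)) \<mu> sequentially" if "i \<in> {1, 2}" for i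
    using tends_in_prob_filterlim[OF iid_sample.sample_mean_tends_in_prob[OF iid int] N]
      that common_mean by metis
  have mean_rv: "sample_mean (X i) m \<in> borel_measurable M" if "i \<in> {1, 2}" for i m
    unfolding sample_mean_def[abs_def] using rv[OF that] by simp
  have var_rv: "sample_var (X i) m \<in> borel_measurable M" if "i \<in> {1, 2}" for i m
  proof -
    note [measurable] = mean_rv[OF that, of m]
    have "(\<lambda>\<omega>. (X i j \<omega> - sample_mean (X i) m \<omega>)\<^sup>2) \<in> borel_measurable M" if "j \<in> {1..m}" for j
    proof -
      have [measurable]: "X i j \<in> borel_measurable M"
        using rv \<open>i \<in> {1, 2}\<close> that by simp
      show ?thesis by measurable
    qed
    then show ?thesis
      unfolding sample_var_def[abs_def] by simp
  qed
  have \<theta>: "(lam 1, lam 2, var 1, var 2, \<mu>, \<mu>) \<in> U"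
    using U(2) lam[of 1] lam[of 2] variance[of 1] variance[of 2] variance_positive
    by (force simp: weight_range_def)
  have cont: "continuous_on U gle" "continuous_on U ggt"
    using smooth by (auto intro: Ck_on_imp_continuous_on)
  have var0: "0 \<le> asymptotic_var g (lam 1) (lam 2) (var 1) (var 2)"
    using lam[of 1] lam[of 2] variance[of 1] variance[of 2] variance_positive
    by (simp add: asymptotic_var_def)

  \<comment> \<open>\<open>A\<close> is the estimation error with the limit weight, and \<open>W\<close> is the factor by which the weight error is multiplied in the remainder.\<close>
  define w where "w i = (if i = (1::nat) then g else 1 - g)" for i
  define A where "A k \<omega> = sqrt (real (n k)) * (\<Sum>i\<in>{1, 2}. w i * (sample_mean (X i) (N i k) \<omega> - \<mu>))"
    for k \<omega>
  define W where "W k \<omega> = sqrt (real (n k)) * (sample_mean (X 1) (N 1 k) \<omega> - sample_mean (X 2) (N 2 k) \<omega>)"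
    for k \<omega>
  have A_rv: "A k \<in> borel_measurable M" for k
    unfolding A_def using mean_rv by simp
  have asym: "(\<Sum>i\<in>{1, 2}. (w i)\<^sup>2 * inverse (lam i) * variance (X i 1))
      = asymptotic_var g (lam 1) (lam 2) (var 1) (var 2)"
    using variance[of 1] variance[of 2] by (simp add: asymptotic_var_def w_def)
  have char_A: "(\<lambda>k. char (distr M borel (A k)) t)
      \<longlonglongrightarrow> char (normal_law 0 (asymptotic_var g (lam 1) (lam 2) (var 1) (var 2))) t" for t
    unfolding char_normal_law[OF var0] unfolding A_def asym[symmetric]
  proof (rule char_weighted_means_tendsto[OF indep])
    show "finite {1, 2::nat}" by simp
    show "0 < lam i" if "i \<in> {1, 2}" for i using lam[OF that] by simp
  qed (rule iid sq common_mean N ratio, assumption)+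

  have W_int: "integrable M (W k)" for k
    unfolding W_def using iid_sample.integrable_sample_mean[OF iid int] by simp
  obtain C where C: "\<forall>\<^sub>F k in sequentially. expectation (\<lambda>\<omega>. \<bar>W k \<omega>\<bar>) \<le> C"
  proof
    define b where "b k = (\<Sum>i\<in>{1, 2}. sqrt (real (n k) / real (N i k)) * sqrt (var i))" for k
    have "b \<longlonglongrightarrow> (\<Sum>i\<in>{1, 2}. sqrt (inverse (lam i)) * sqrt (var i))"
      unfolding b_def by (intro tendsto_intros ratio)
    then have "\<forall>\<^sub>F k in sequentially. b k < (\<Sum>i\<in>{1, 2}. sqrt (inverse (lam i)) * sqrt (var i)) + 1"
      by (rule order_tendstoD) simp
    moreover have "\<forall>\<^sub>F k in sequentially. 1 \<le> min (N 1 k) (N 2 k)"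
      using sizes by (simp add: filterlim_at_top)
    ultimately show "\<forall>\<^sub>F k in sequentially. expectation (\<lambda>\<omega>. \<bar>W k \<omega>\<bar>)
        \<le> (\<Sum>i\<in>{1, 2}. sqrt (inverse (lam i)) * sqrt (var i)) + 1"
    proof eventually_elim
      case (elim k)
      define D where "D i \<omega> = \<bar>sample_mean (X i) (N i k) \<omega> - \<mu>\<bar>" for i \<omega>
      have D_int: "integrable M (D i)" if "i \<in> {1, 2}" for i
        unfolding D_def using iid_sample.integrable_sample_mean[OF iid int] that by simp
      have D_le: "sqrt (real (n k)) * expectation (D i) \<le> sqrt (real (n k) / real (N i k)) * sqrt (var i)"
        if i: "i \<in> {1, 2}" for i
      proof -
        have "1 \<le> N i k" using elim i by auto
        then have "expectation (D i) \<le> sqrt (var i / real (N i k))"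
          using iid_sample.expectation_abs_sample_mean_le[OF iid[OF i] sq[OF i]]
          unfolding D_def variance[OF i] common_mean[OF i] by simp
        then have "sqrt (real (n k)) * expectation (D i) \<le> sqrt (real (n k)) * sqrt (var i / real (N i k))"
          by (intro mult_left_mono) auto
        then show ?thesis by (simp add: real_sqrt_divide)
      qed
      have "expectation (\<lambda>\<omega>. \<bar>W k \<omega>\<bar>) \<le> expectation (\<lambda>\<omega>. sqrt (real (n k)) * (D 1 \<omega> + D 2 \<omega>))"
      proof (rule integral_mono)
        fix \<omega>
        have "\<bar>W k \<omega>\<bar> = sqrt (real (n k)) * \<bar>sample_mean (X 1) (N 1 k) \<omega> - sample_mean (X 2) (N 2 k) \<omega>\<bar>"
          by (simp add: W_def abs_mult)
        also have "\<dots> \<le> sqrt (real (n k)) * (D 1 \<omega> + D 2 \<omega>)"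
          by (rule mult_left_mono) (auto simp: D_def)
        finally show "\<bar>W k \<omega>\<bar> \<le> sqrt (real (n k)) * (D 1 \<omega> + D 2 \<omega>)" .
      qed (use W_int D_int in auto)
      also have "\<dots> = sqrt (real (n k)) * expectation (D 1) + sqrt (real (n k)) * expectation (D 2)"
        using D_int by (simp add: distrib_left)
      also have "\<dots> \<le> b k"
        using D_le[of 1] D_le[of 2] by (simp add: b_def)
      finally show ?case using elim by simp
    qed
  qed

  fix V :: "(nat \<Rightarrow> 'w \<Rightarrow> real) \<Rightarrow> nat \<Rightarrow> 'w \<Rightarrow> real"
  assume V: "V \<in> {unbiased_sample_var, sample_var}"
  have V_lim: "tends_in_prob M (\<lambda>k. V (X i) (N i k)) (var i) sequentially" if i: "i \<in> {1, 2}" for i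
  proof -
    have "tends_in_prob M (V (X i)) (var i) sequentially"
      using V iid_sample.sample_var_tends_in_prob[OF iid[OF i] sq[OF i]]
        iid_sample.unbiased_sample_var_tends_in_prob[OF iid[OF i] sq[OF i]]
      unfolding variance[OF i] by blast
    then show ?thesis using N[OF i] by (rule tends_in_prob_filterlim)
  qed
  have V_rv: "V (X i) m \<in> borel_measurable M" if i: "i \<in> {1, 2}" for i m
    using V var_rv[OF i, of m] by (auto simp: unbiased_sample_var_def[abs_def])
  have V0: "0 \<le> V (X i) m \<omega>" if "1 \<le> m" for i m \<omega>
    using V that by (auto simp: unbiased_sample_var_def sample_var_def intro!: mult_nonneg_nonneg
        divide_nonneg_nonneg sum_nonneg)
  define G where "G k = random_weight V gle ggt X (N 1 k) (N 2 k)" for k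
  have G_lim: "tends_in_prob M G g sequentially"
    unfolding G_def
  proof (rule random_weight_tends_in_prob)
    show "isCont gle (lam 1, lam 2, var 1, var 2, \<mu>, \<mu>)" "isCont ggt (lam 1, lam 2, var 1, var 2, \<mu>, \<mu>)"
      using cont \<theta> U(1) by (simp_all add: continuous_on_eq_continuous_at)
  qed (use fractions V_lim mean tie g prob_space_axioms in auto)
  have U_lim: "tends_in_prob M (\<lambda>k \<omega>. G k \<omega> - g) 0 sequentially"
    using tends_in_prob_continuous[OF G_lim, of "\<lambda>x. x - g"] by simp
  define T where "T k \<omega> = sqrt (real (n k)) * (common_mean_estimator V gle ggt X (N 1 k) (N 2 k) \<omega> - \<mu>)"
    for k \<omega>
  \<comment> \<open>The two weights sum to 1, so the common mean cancels and the weight error meets only the difference of the sample means.\<close>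
  have T_eq: "T k \<omega> = A k \<omega> + (G k \<omega> - g) * W k \<omega>" for k \<omega>
    by (simp add: T_def A_def W_def G_def w_def common_mean_estimator_def algebra_simps)
  have "\<forall>\<^sub>F k in sequentially. 1 \<le> min (N 1 k) (N 2 k)"
    using sizes by (simp add: filterlim_at_top)
  then have T_rv: "\<forall>\<^sub>F k in sequentially. T k \<in> borel_measurable M"
  proof eventually_elim
    case (elim k)
    have "G k \<in> borel_measurable M"
      unfolding G_def
      by (rule random_weight_measurable) (use elim V_rv V0 mean_rv U cont in auto)
    then show ?case
      unfolding T_eq[abs_def] using A_rv[of k] borel_measurable_integrable[OF W_int[of k]] by simp
  qed
  have "weak_conv_m (\<lambda>k. distr M borel (T k))
      (normal_law 0 (asymptotic_var g (lam 1) (lam 2) (var 1) (var 2)))"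
  proof (rule levy_continuity_eventually)
    show "\<forall>\<^sub>F k in sequentially. real_distribution (distr M borel (T k))"
      using T_rv by eventually_elim (rule real_distribution_distr)
    show "real_distribution (normal_law 0 (asymptotic_var g (lam 1) (lam 2) (var 1) (var 2)))"
      by (rule real_distribution_normal_law[OF var0])
    show "(\<lambda>k. char (distr M borel (T k)) t)
        \<longlonglongrightarrow> char (normal_law 0 (asymptotic_var g (lam 1) (lam 2) (var 1) (var 2))) t" for t
      by (rule Lim_transform[OF char_A char_distr_Slutsky[OF T_rv A_rv W_int C T_eq U_lim]])
  qed
  then show "weak_conv_m
      (\<lambda>k. distr M borel (\<lambda>\<omega>. sqrt (real (N 1 k + N 2 k)) *
             (common_mean_estimator V gle ggt X (N 1 k) (N 2 k) \<omega> - \<mu>)))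
      (normal_law 0 (asymptotic_var g (lam 1) (lam 2) (var 1) (var 2)))"
    unfolding T_def n_def .
qed

end
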